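(* Let $\Lambda$ be the shape function. Then $\Lambda(0)=c$, $\Lambda(1)=\Lambda(-1)=0$, and $\Lambda(\alpha)>c(1-|\alpha|)$ for all $0<|\alpha|<1$. Moreover, there is a constant $K>0$ such that $\Lambda(\alpha)\le c-K|\alpha|$ for all $\alpha\in[-1,1]$.
   Context: Let $c>0$, $q>0$, $\kappa>-1$. $F=(F(x))_{x\in\mathbb Z}$ and $B=(B(i))_{i\in\mathbb Z}$ are mutually independent families of i.i.d. random variables, $\mathbb P(B(i)=\pm1)=1/2$, and $F(x)$ has a density $\varrho$ that is even, continuous, strictly positive on $(-c,c)$, zero outside $(-c,c)$, with $\lim_{x\to c}\varrho(x)/|c-x|^{\kappa}=q$. Lazy walks $\gamma$ satisfy $|\gamma(i+1)-\gamma(i)|\le 1$; for a lazy walk $\gamma$ on $\{0,\dots,n\}$ the action is $A(B,F;\gamma)=\sum_{i=1}^n B(i)F(\gamma(i))$, and $\bar A(B,F;n,k)$ is the minimum of the action over lazy walks with $\gamma(0)=0$, $\gamma(n)=k$. $[x]$ denotes rounding towards $0$. The shape function is the deterministic continuous even concave function $\Lambda:[-1,1]\to[0,\infty)$ such that almost surely, for all $\alpha\in[-1,1]$, $\bar A(B,F;n,[\alpha n])/n\to-\Lambda(\alpha)$ as $n\to\infty$. *)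

theory Defs
  imports "HOL-Probability.Probability"
begin

definition round0 :: "real \<Rightarrow> int" where
  "round0 x = (if x \<ge> 0 then \<lfloor>x\<rfloor> else \<lceil>x\<rceil>)"

text \<open>A lazy walk on the time interval 0..n (only its values on 0..n matter).\<close>
definition lazy_walk :: "nat \<Rightarrow> (nat \<Rightarrow> int) \<Rightarrow> bool" where
  "lazy_walk n \<gamma> \<longleftrightarrow> (\<forall>i<n. \<bar>\<gamma> (Suc i) - \<gamma> i\<bar> \<le> 1)"

definition action :: "(int \<Rightarrow> real) \<Rightarrow> (int \<Rightarrow> real) \<Rightarrow> nat \<Rightarrow> (nat \<Rightarrow> int) \<Rightarrow> real" where
  "action B F n \<gamma> = (\<Sum>i=1..n. B (int i) * F (\<gamma> i))"

definition min_action :: "(int \<Rightarrow> real) \<Rightarrow> (int \<Rightarrow> real) \<Rightarrow> nat \<Rightarrow> int \<Rightarrow> real" where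
  "min_action B F n k =
     Min {action B F n \<gamma> | \<gamma>. lazy_walk n \<gamma> \<and> \<gamma> 0 = 0 \<and> \<gamma> n = k}"

definition is_shape_function ::
  "'a measure \<Rightarrow> (int \<Rightarrow> 'a \<Rightarrow> real) \<Rightarrow> (int \<Rightarrow> 'a \<Rightarrow> real) \<Rightarrow> (real \<Rightarrow> real) \<Rightarrow> bool" where
  "is_shape_function M B F \<Lambda> \<longleftrightarrow>
     continuous_on {-1..1} \<Lambda> \<and>
     (\<forall>\<alpha>\<in>{-1..1}. \<Lambda> (-\<alpha>) = \<Lambda> \<alpha>) \<and>
     concave_on {-1..1} \<Lambda> \<and>
     (\<forall>\<alpha>\<in>{-1..1}. \<Lambda> \<alpha> \<ge> 0) \<and>
     (AE \<omega> in M. \<forall>\<alpha>\<in>{-1..1}.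
        (\<lambda>n. min_action (\<lambda>i. B i \<omega>) (\<lambda>x. F x \<omega>) n (round0 (\<alpha> * real n)) / real n)
          \<longlonglongrightarrow> - \<Lambda> \<alpha>)"

end

theory Submission
  imports Defs
begin

text \<open>
  The limit of the minimal action is bounded from both sides by expectations of explicit
  minorants and majorants.

  At speed 0, almost surely there are neighbouring sites with \<open>F\<close> close to \<open>c\<close> and to \<open>-c\<close>; a walk
  oscillating between them according to the sign of \<open>B\<close> loses almost nothing. At speed 1 the walk is
  unique and its action has mean 0. A walk of speed \<open>\<alpha>\<close> visits all sites \<open>1..\<alpha>n\<close>, and each visit of
  \<open>x\<close> costs at least \<open>c - \<bar>F x\<bar>\<close> compared with the bound \<open>-c\<close> per step, so \<open>K = c - E\<bar>F\<bar>\<close> works.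

  By concavity, strictness is needed at one speed only. Take \<open>\<alpha> = m/(m+1)\<close> and cut time
  into blocks of \<open>m + 1\<close> steps, in each of which the walk pauses once, at the start or at the end,
  whichever is better. The two actions have mean 0 and differ by a sum \<open>S\<close> of \<open>m\<close> uncorrelated
  terms with random signs, so the expected minimum is \<open>-E\<bar>S\<bar>/2\<close>. Comparing second and fourth moments,
  \<open>E\<bar>S\<bar>\<close> grows like \<open>\<surd>m\<close> and eventually exceeds \<open>2c\<close>, whereas the chord only accounts for \<open>c\<close> per block.
\<close>

section \<open>Lazy walks\<close>

lemma lazy_walk_abs_le:
  assumes "lazy_walk n \<gamma>" "\<gamma> 0 = 0" "i \<le> n"
  shows "\<bar>\<gamma> i\<bar> \<le> int i"
  using assms(3)
proof (induction i)
  case (Suc i)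
  then have "\<bar>\<gamma> (Suc i) - \<gamma> i\<bar> \<le> 1" using assms(1) by (simp add: lazy_walk_def)
  with Suc show ?case by simp
qed (simp add: assms)

section \<open>Attainment of the minimal action and bounds on it\<close>

lemma action_cong:
  "(\<And>i. 1 \<le> i \<Longrightarrow> i \<le> n \<Longrightarrow> \<gamma> i = \<delta> i) \<Longrightarrow> action B F n \<gamma> = action B F n \<delta>"
  unfolding action_def by (intro sum.cong) auto

text \<open>\<open>Min\<close> is meaningful only on finite sets. Walks are functions on all of
  \<open>nat\<close>, so infinitely many are admissible, but the action sees only the values on
  \<open>{0..n}\<close>, and those lie in \<open>{- int n..int n}\<close>.\<close>

lemma finite_actions:
  "finite {action B F n \<gamma> | \<gamma>. lazy_walk n \<gamma> \<and> \<gamma> 0 = 0 \<and> \<gamma> n = k}"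
proof (rule finite_subset)
  show "finite (action B F n ` PiE {0..n} (\<lambda>_. {- int n..int n}))"
    by (intro finite_imageI finite_PiE) auto
  show "{action B F n \<gamma> | \<gamma>. lazy_walk n \<gamma> \<and> \<gamma> 0 = 0 \<and> \<gamma> n = k}
      \<subseteq> action B F n ` PiE {0..n} (\<lambda>_. {- int n..int n})"
  proof clarify
    fix \<gamma> assume *: "lazy_walk n \<gamma>" "\<gamma> 0 = 0"
    have "\<bar>\<gamma> i\<bar> \<le> int n" if "i \<le> n" for i
      using lazy_walk_abs_le[OF * that] that by linarith
    then have "restrict \<gamma> {0..n} \<in> PiE {0..n} (\<lambda>_. {- int n..int n})"
      by (force simp: abs_le_iff)
    moreover have "action B F n \<gamma> = action B F n (restrict \<gamma> {0..n})"
      by (rule action_cong) auto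
    ultimately show "action B F n \<gamma> \<in> action B F n ` PiE {0..n} (\<lambda>_. {- int n..int n})"
      by blast
  qed
qed

lemma min_action_le:
  assumes "lazy_walk n \<gamma>" "\<gamma> 0 = 0" "\<gamma> n = k"
  shows "min_action B F n k \<le> action B F n \<gamma>"
  unfolding min_action_def using assms by (intro Min_le finite_actions) auto

text \<open>The condition on \<open>k\<close> guarantees an admissible walk; otherwise
  \<open>Min\<close> would be taken over the empty set and be unspecified.\<close>

lemma le_min_action:
  assumes "\<bar>k\<bar> \<le> int n"
    and "\<And>\<gamma>. lazy_walk n \<gamma> \<Longrightarrow> \<gamma> 0 = 0 \<Longrightarrow> \<gamma> n = k \<Longrightarrow> a \<le> action B F n \<gamma>"
  shows "a \<le> min_action B F n k"
proof -
  \<comment> \<open>An explicit competitor: walk straight to \<open>k\<close>, then stay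
    there.\<close>
  let ?\<gamma> = "\<lambda>i. sgn k * min (int i) \<bar>k\<bar>"
  have "lazy_walk n ?\<gamma>" "?\<gamma> 0 = 0" "?\<gamma> n = k"
    using assms(1) by (auto simp: lazy_walk_def sgn_if min_def)
  then have "{action B F n \<gamma> | \<gamma>. lazy_walk n \<gamma> \<and> \<gamma> 0 = 0 \<and> \<gamma> n = k} \<noteq> {}"
    by blast
  then show ?thesis
    unfolding min_action_def using assms(2) by (subst Min_ge_iff) (auto intro: finite_actions)
qed

text \<open>Going backwards from time \<open>n\<close>, the walk cannot lag behind the diagonal;
  \<open>lazy_walk_abs_le\<close> says that it cannot be ahead of it.\<close>

lemma lazy_walk_straight:
  assumes "lazy_walk n \<gamma>" "\<gamma> 0 = 0" "\<gamma> n = int n" "i \<le> n"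
  shows "\<gamma> i = int i"
proof -
  have "\<gamma> i \<ge> int n - int d" if "i + d = n" for d
    using that
  proof (induction d arbitrary: i)
    case (Suc d)
    then have "\<gamma> (Suc i) \<ge> int n - int d" by simp
    moreover have "\<bar>\<gamma> (Suc i) - \<gamma> i\<bar> \<le> 1" using assms(1) Suc.prems by (simp add: lazy_walk_def)
    ultimately show ?case by simp
  qed (use assms in simp)
  from this[of "n - i"] show ?thesis
    using lazy_walk_abs_le[OF assms(1,2,4)] assms(4) by simp
qed

lemma lazy_walk_visits:
  assumes "lazy_walk n \<gamma>" "\<gamma> 0 = 0" "0 < x" "x \<le> \<gamma> n"
  shows "\<exists>i\<in>{1..n}. \<gamma> i = x"
proof -
  have "\<exists>i\<le>n. \<gamma> i = x"
    using assms by (intro nat0_intermed_int_val) (auto simp: lazy_walk_def)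
  then obtain i where "i \<le> n" "\<gamma> i = x" by blast
  \<comment> \<open>Time 0 must be excluded because \<open>action\<close> starts summing at time
    1.\<close>
  moreover from this have "i \<noteq> 0" using assms by (metis less_irrefl)
  ultimately show ?thesis by auto
qed

text \<open>Relative to \<open>- c\<close> per step, being at \<open>x\<close> loses at least
  \<open>c - \<bar>F x\<bar>\<close>, which is nonnegative. Hence it suffices to charge each site of
  \<open>1..\<gamma> n\<close> once. For \<open>\<gamma> n \<le> 0\<close> the sum is empty and the
  bound is the trivial one.\<close>

lemma action_ge_visited:
  assumes "lazy_walk n \<gamma>" "\<gamma> 0 = 0"
    and B: "\<And>i. \<bar>B i\<bar> \<le> 1" and F: "\<And>x. \<bar>F x\<bar> \<le> c"
  shows "(\<Sum>x=1..\<gamma> n. c - \<bar>F x\<bar>) - c * real n \<le> action B F n \<gamma>"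
proof -
  have loss: "c - \<bar>F x\<bar> \<le> c + B i * F x" for i x
    using mult_right_mono[OF B[of i] abs_ge_zero[of "F x"]] by (simp add: abs_mult[symmetric])
  have "(\<Sum>x=1..\<gamma> n. c - \<bar>F x\<bar>) \<le> (\<Sum>x\<in>\<gamma> ` {1..n}. c - \<bar>F x\<bar>)"
    using lazy_walk_visits[OF assms(1,2)] F by (intro sum_mono2) force+
  also have "\<dots> \<le> sum ((\<lambda>x. c - \<bar>F x\<bar>) \<circ> \<gamma>) {1..n}"
    using F by (intro sum_image_le) auto
  also have "\<dots> \<le> (\<Sum>i=1..n. c + B (int i) * F (\<gamma> i))"
    by (intro sum_mono) (simp only: comp_def loss)
  also have "\<dots> = c * real n + action B F n \<gamma>"
    by (simp add: action_def sum.distrib)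
  finally show ?thesis by simp
qed

text \<open>The second walk runs on its own clock \<open>0..m\<close>, so only the index of
  \<open>B\<close> is shifted by \<open>n\<close>; the sites are absolute.\<close>

lemma lazy_walk_append:
  assumes "lazy_walk n \<gamma>" "lazy_walk m \<delta>" "\<delta> 0 = \<gamma> n"
  defines "\<eta> \<equiv> \<lambda>i. if i \<le> n then \<gamma> i else \<delta> (i - n)"
  shows "lazy_walk (n + m) \<eta>" "\<eta> 0 = \<gamma> 0" "\<eta> (n + m) = \<delta> m"
    "action B F (n + m) \<eta> = action B F n \<gamma> + (\<Sum>i=1..m. B (int (n + i)) * F (\<delta> i))"
proof -
  show "lazy_walk (n + m) \<eta>"
    unfolding lazy_walk_def
  proof (intro allI impI)
    fix i assume "i < n + m"
    consider "i < n" | "i = n" | "n < i" by linarith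
    then show "\<bar>\<eta> (Suc i) - \<eta> i\<bar> \<le> 1"
    proof cases
      case 2
      then have "0 < m" using \<open>i < n + m\<close> by simp
      then have "\<bar>\<delta> (Suc 0) - \<delta> 0\<bar> \<le> 1" using assms(2) unfolding lazy_walk_def by blast
      then show ?thesis using 2 assms(3) by (simp add: \<eta>_def)
    next
      case 3
      then show ?thesis using assms(2) \<open>i < n + m\<close> by (simp add: \<eta>_def lazy_walk_def Suc_diff_le)
    qed (use assms(1) in \<open>simp add: \<eta>_def lazy_walk_def\<close>)
  qed
  show "\<eta> 0 = \<gamma> 0" "\<eta> (n + m) = \<delta> m" using assms(3) by (auto simp: \<eta>_def)
  have "action B F (n + m) \<eta> = action B F n \<eta> + (\<Sum>i=n+1..n+m. B (int i) * F (\<eta> i))"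
    unfolding action_def by (rule sum.ub_add_nat) simp
  also have "action B F n \<eta> = action B F n \<gamma>"
    by (rule action_cong) (simp add: \<eta>_def)
  also have "(\<Sum>i=n+1..n+m. B (int i) * F (\<eta> i)) = (\<Sum>i=1..m. B (int (n + i)) * F (\<delta> i))"
    using sum.shift_bounds_cl_nat_ivl[of "\<lambda>i. B (int i) * F (\<eta> i)" 1 n m]
    by (auto simp: add.commute \<eta>_def intro!: sum.cong)
  finally show "action B F (n + m) \<eta> = action B F n \<gamma> + (\<Sum>i=1..m. B (int (n + i)) * F (\<delta> i))" .
qed

section \<open>Blocks with a single pause\<close>

text \<open>Actions, over the times \<open>t + 1..t + m + 1\<close>, of the two walks from \<open>x\<close> to \<open>x + m\<close> that move right
  at every step except the first, respectively the last.\<close>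
definition pause_first :: "(int \<Rightarrow> real) \<Rightarrow> (int \<Rightarrow> real) \<Rightarrow> nat \<Rightarrow> nat \<Rightarrow> nat \<Rightarrow> real" where
  "pause_first B F m t x = (\<Sum>i=1..Suc m. B (int (t + i)) * F (int (x + (i - 1))))"

definition pause_last :: "(int \<Rightarrow> real) \<Rightarrow> (int \<Rightarrow> real) \<Rightarrow> nat \<Rightarrow> nat \<Rightarrow> nat \<Rightarrow> real" where
  "pause_last B F m t x = (\<Sum>i=1..Suc m. B (int (t + i)) * F (int (x + min i m)))"

text \<open>Block \<open>j\<close> starts at time \<open>Suc m * j\<close> and site
  \<open>m * j\<close> whatever was chosen earlier, so the better of the two pauses can be picked
  separately in each block and the pieces concatenated.\<close>

lemma min_action_blocks_le:
  "min_action B F (Suc m * k) (int (m * k))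
     \<le> (\<Sum>j<k. min (pause_first B F m (Suc m * j) (m * j)) (pause_last B F m (Suc m * j) (m * j)))"
proof -
  have "\<exists>\<gamma>. lazy_walk (Suc m * k) \<gamma> \<and> \<gamma> 0 = 0 \<and> \<gamma> (Suc m * k) = int (m * k) \<and>
      action B F (Suc m * k) \<gamma>
        = (\<Sum>j<k. min (pause_first B F m (Suc m * j) (m * j)) (pause_last B F m (Suc m * j) (m * j)))"
  proof (induction k)
    case 0
    show ?case by (rule exI[of _ "\<lambda>_. 0"]) (auto simp: lazy_walk_def action_def)
  next
    case (Suc k)
    then obtain \<gamma> where \<gamma>: "lazy_walk (Suc m * k) \<gamma>" "\<gamma> 0 = 0" "\<gamma> (Suc m * k) = int (m * k)"
      and act: "action B F (Suc m * k) \<gamma>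
        = (\<Sum>j<k. min (pause_first B F m (Suc m * j) (m * j)) (pause_last B F m (Suc m * j) (m * j)))"
      by blast
    \<comment> \<open>Truncated subtraction makes \<open>i - 1\<close> equal to 0 at both
      \<open>i = 0\<close> and \<open>i = 1\<close>, which is the pause at the start;
      \<open>min i m\<close> stalls at the end.\<close>
    define \<delta> where "\<delta> i = (if pause_first B F m (Suc m * k) (m * k) \<le> pause_last B F m (Suc m * k) (m * k)
      then int (m * k + (i - 1)) else int (m * k + min i m))" for i
    have \<delta>: "lazy_walk (Suc m) \<delta>" "\<delta> 0 = \<gamma> (Suc m * k)" "\<delta> (Suc m) = int (m * Suc k)"
      using \<gamma>(3) by (auto simp: \<delta>_def lazy_walk_def min_def)
    have "(\<Sum>i=1..Suc m. B (int (Suc m * k + i)) * F (\<delta> i))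
      = min (pause_first B F m (Suc m * k) (m * k)) (pause_last B F m (Suc m * k) (m * k))"
      unfolding min_def
      by (cases "pause_first B F m (Suc m * k) (m * k) \<le> pause_last B F m (Suc m * k) (m * k)")
        (simp_all only: \<delta>_def if_True if_False pause_first_def[symmetric] pause_last_def[symmetric])
    with lazy_walk_append[OF \<gamma>(1) \<delta>(1,2)] \<gamma>(2) \<delta>(3) act show ?case
      by (intro exI[of _ "\<lambda>i. if i \<le> Suc m * k then \<gamma> i else \<delta> (i - Suc m * k)"])
        (simp add: add.commute)
  qed
  then show ?thesis by (metis min_action_le)
qed

text \<open>At time \<open>t + i\<close> with \<open>i \<le> m\<close> the two walks sit on the
  adjacent sites \<open>x + i - 1\<close> and \<open>x + i\<close>. At time \<open>t + m + 1\<close>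
  both are at \<open>x + m\<close> and the terms cancel, which leaves \<open>m\<close>
  summands.\<close>

lemma pause_first_diff_pause_last:
  "pause_first B F m t x - pause_last B F m t x
     = (\<Sum>i<m. B (int t + 1 + int i) * (F (int x + int i) - F (int x + int i + 1)))"
proof -
  have "pause_first B F m t x - pause_last B F m t x
      = (\<Sum>i=1..Suc m. B (int (t + i)) * (F (int (x + (i - 1))) - F (int (x + min i m))))"
    unfolding pause_first_def pause_last_def by (simp only: sum_subtractf[symmetric] right_diff_distrib)
  also have "\<dots> = (\<Sum>i<Suc m. B (int (t + Suc i)) * (F (int (x + i)) - F (int (x + min (Suc i) m))))"
    by (simp only: sum.atLeast1_atMost_eq One_nat_def diff_Suc_Suc diff_zero)
  also have "\<dots> = (\<Sum>i<m. B (int t + 1 + int i) * (F (int x + int i) - F (int x + int i + 1)))"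
    by (simp add: add_ac)
  finally show ?thesis .
qed

lemma min_action_trap_le:
  fixes x :: nat
  assumes B: "\<And>i. B i = 1 \<or> B i = - 1" and F: "\<And>x. \<bar>F x\<bar> \<le> c"
    and hi: "F (int x) \<ge> b" and lo: "F (int x + 1) \<le> - b" and n: "2 * x < n" and b: "b \<le> c"
  shows "min_action B F n 0 \<le> 2 * c * (2 * real x + 1) - b * real n"
proof -
  \<comment> \<open>Walk to \<open>x\<close>, then sit on \<open>x + 1\<close> when \<open>B\<close>
    is 1 and on \<open>x\<close> when \<open>B\<close> is -1, and spend the last \<open>x\<close>
    steps returning to 0.\<close>
  define \<gamma> :: "nat \<Rightarrow> int" where "\<gamma> i = (if i \<le> x then int i else if n \<le> i + x then int (n - i)
    else int x + (if B (int i) = 1 then 1 else 0))" for i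
  \<comment> \<open>The travel times, at most \<open>2 * x + 1\<close> of them. There a step costs
    at most \<open>c\<close>, which is below \<open>2 * c - b\<close> because
    \<open>b \<le> c\<close>; all other steps gain \<open>b\<close>.\<close>
  let ?E = "{i\<in>{1..n}. i \<le> x \<or> n \<le> i + x}"
  have "lazy_walk n \<gamma>" "\<gamma> 0 = 0" "\<gamma> n = 0"
    using n by (auto simp: lazy_walk_def \<gamma>_def)
  then have "min_action B F n 0 \<le> action B F n \<gamma>"
    by (rule min_action_le)
  also have "\<dots> \<le> (\<Sum>i=1..n. (if i \<in> ?E then 2 * c else 0) - b)"
    unfolding action_def
  proof (rule sum_mono)
    fix i assume i: "i \<in> {1..n}"
    have "B (int i) * F (\<gamma> i) \<le> c" using B[of "int i"] F[of "\<gamma> i"] by auto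
    moreover have "B (int i) * F (\<gamma> i) \<le> - b" if "i \<notin> ?E"
      using that i B[of "int i"] hi lo by (auto simp: \<gamma>_def)
    ultimately show "B (int i) * F (\<gamma> i) \<le> (if i \<in> ?E then 2 * c else 0) - b"
      using b by auto
  qed
  also have "\<dots> = 2 * c * real (card ?E) - b * real n"
    by (simp add: sum_subtractf sum.If_cases Int_def)
  also have "card ?E \<le> card ({1..x} \<union> {n - x..n})"
    by (rule card_mono) auto
  also have "\<dots> \<le> card {1..x} + card {n - x..n}" by (rule card_Un_le)
  also have "\<dots> = 2 * x + 1" using n by simp
  finally show ?thesis using F[of 0] by (simp add: mult_left_mono add.commute)
qed

section \<open>Independence and limits of expectations\<close>

text \<open>The sigma-algebra generated by the variables with index in \<open>J\<close>. Pulling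
  back the product along the restricted tuple matches the form in which
  \<open>indep_var_restrict\<close> gives independence of disjoint groups.\<close>

definition (in prob_space) gen_alg :: "('i \<Rightarrow> 'a \<Rightarrow> real) \<Rightarrow> 'i set \<Rightarrow> 'a measure" where
  "gen_alg X J = vimage_algebra (space M) (\<lambda>\<omega>. \<lambda>j\<in>J. X j \<omega>) (PiM J (\<lambda>_. borel))"

lemma (in prob_space) measurable_gen_alg:
  "j \<in> J \<Longrightarrow> X j \<in> borel_measurable (gen_alg X J)"
proof -
  assume j: "j \<in> J"
  have "(\<lambda>\<omega>. \<lambda>j\<in>J. X j \<omega>) \<in> measurable (gen_alg X J) (PiM J (\<lambda>_. borel))"
    unfolding gen_alg_def by (rule measurable_vimage_algebra1) (auto simp: space_PiM)
  from measurable_compose[OF this measurable_component_singleton[OF j]]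
  show ?thesis using j by simp
qed

text \<open>Preimages under \<open>f\<close> and \<open>g\<close> form sub-sigma-algebras of the two
  generated ones, and independence passes to smaller set systems. Checking membership in
  \<open>gen_alg\<close> then replaces writing \<open>f\<close> and \<open>g\<close> as explicit
  functions of tuples.\<close>

lemma (in prob_space) indep_var_gen_alg:
  fixes f g :: "'a \<Rightarrow> real"
  assumes "indep_vars (\<lambda>_. borel) X I" "J \<inter> K = {}" "J \<subseteq> I" "K \<subseteq> I"
    and f: "f \<in> borel_measurable (gen_alg X J)" and g: "g \<in> borel_measurable (gen_alg X K)"
  shows "indep_var borel f borel g"
proof -
  have ind: "indep_set (sets (gen_alg X J)) (sets (gen_alg X K))"
    using indep_var_restrict[OF assms(1-4)]
    unfolding gen_alg_def sets_vimage_algebra indep_var_eq by simp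
  have sp: "space (gen_alg X L) = space M" for L
    by (simp add: gen_alg_def)
  have sub: "sets (gen_alg X J) \<subseteq> events" "sets (gen_alg X K) \<subseteq> events"
    using ind unfolding indep_set_def indep_sets_def by (auto split: bool.splits)
  have *: "sigma_sets (space M) {h -` A \<inter> space M | A. A \<in> sets borel} \<subseteq> sets (gen_alg X L)"
    if "h \<in> borel_measurable (gen_alg X L)" for h :: "'a \<Rightarrow> real" and L
    using sets.sigma_sets_subset[of "{h -` A \<inter> space M | A. A \<in> sets borel}" "gen_alg X L"]
      measurable_sets[OF that] unfolding sp by blast
  have **: "h \<in> borel_measurable M"
    if "h \<in> borel_measurable (gen_alg X L)" "sets (gen_alg X L) \<subseteq> events" for h :: "'a \<Rightarrow> real" and L
    using that unfolding measurable_def sp by blast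
  have "indep_set (sigma_sets (space M) {f -` A \<inter> space M | A. A \<in> sets borel})
      (sigma_sets (space M) {g -` A \<inter> space M | A. A \<in> sets borel})"
    using ind unfolding indep_set_def
    by (rule indep_sets_mono_sets) (use *[OF f] *[OF g] in \<open>auto split: bool.splits\<close>)
  then show ?thesis
    unfolding indep_var_eq using **[OF f sub(1)] **[OF g sub(2)] by blast
qed

text \<open>Truncating the minorants at the limit keeps them dominated while forcing their convergence,
  so nothing needs to be known about the measurability of the converging sequence itself.\<close>
lemma (in prob_space) expectation_le_AE_limit:
  fixes V X :: "nat \<Rightarrow> 'a \<Rightarrow> real"
  assumes lim: "AE \<omega> in M. (\<lambda>n. X n \<omega>) \<longlonglongrightarrow> l"
    and V: "\<And>n. V n \<in> borel_measurable M" "\<And>n. AE \<omega> in M. \<bar>V n \<omega>\<bar> \<le> C"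
    and le: "\<And>n. AE \<omega> in M. V n \<omega> \<le> X n \<omega>"
    and b: "b \<longlonglongrightarrow> b'" "\<And>n. b n \<le> expectation (V n)"
  shows "b' \<le> l"
proof -
  let ?W = "\<lambda>n \<omega>. max (V n \<omega>) l"
  have "(\<lambda>n. expectation (?W n)) \<longlonglongrightarrow> expectation (\<lambda>_. l)"
  proof (rule integral_dominated_convergence[where w="\<lambda>_. \<bar>C\<bar> + \<bar>l\<bar>"])
    have "AE \<omega> in M. \<forall>n. V n \<omega> \<le> X n \<omega>" using le by (simp add: AE_all_countable)
    with lim show "AE \<omega> in M. (\<lambda>n. ?W n \<omega>) \<longlonglongrightarrow> l"
    proof eventually_elim
      case (elim \<omega>)
      have "(\<lambda>n. max (X n \<omega>) l) \<longlonglongrightarrow> max l l"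
        by (intro tendsto_max elim tendsto_const)
      moreover have "?W n \<omega> \<le> max (X n \<omega>) l" for n
        using elim(2) by (intro max.mono) auto
      ultimately show ?case
        using tendsto_sandwich[of "\<lambda>_. l" "\<lambda>n. ?W n \<omega>" _ "\<lambda>n. max (X n \<omega>) l"] by simp
    qed
    show "AE \<omega> in M. norm (?W n \<omega>) \<le> \<bar>C\<bar> + \<bar>l\<bar>" for n
      using V(2)[of n] by eventually_elim auto
  qed (use V in auto)
  then have "(\<lambda>n. expectation (?W n)) \<longlonglongrightarrow> l" by (simp add: prob_space)
  moreover have "b n \<le> expectation (?W n)" for n
  proof -
    have "expectation (V n) \<le> expectation (?W n)"
    proof (rule integral_mono)
      show "integrable M (V n)" using V by (intro integrable_const_bound[where B=C]) auto
      show "integrable M (?W n)"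
        using V(1) by (intro integrable_const_bound[where B="\<bar>C\<bar> + \<bar>l\<bar>"])
          (rule eventually_mono[OF V(2)[of n]], auto)
    qed auto
    with b(2)[of n] show ?thesis by simp
  qed
  ultimately show ?thesis using b(1) by (meson LIMSEQ_le)
qed

text \<open>With \<open>u = \<bar>s\<bar> / \<mu>\<close> this is
  \<open>u\<^sup>2 - u ^ 4 \<le> u\<close>. After integration it bounds a first absolute moment
  below by the second and fourth moments, with a free scale \<open>\<mu>\<close> to optimise, in
  place of Hoelder's inequality.\<close>

lemma abs_ge_sq_minus_pow4:
  fixes s \<mu> :: real
  assumes "0 < \<mu>"
  shows "s\<^sup>2 / \<mu> - s ^ 4 / \<mu> ^ 3 \<le> \<bar>s\<bar>"
proof -
  define u where "u = \<bar>s\<bar> / \<mu>"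
  have s: "\<bar>s\<bar> = u * \<mu>" and u: "0 \<le> u" using assms by (auto simp: u_def)
  have "u\<^sup>2 - u ^ 4 \<le> u"
  proof (cases "u \<le> 1")
    case True
    then have "u\<^sup>2 \<le> u" using u by (simp add: power2_eq_square mult_left_le)
    moreover have "0 \<le> u ^ 4" by simp
    ultimately show ?thesis by linarith
  next
    case False
    then have "u\<^sup>2 \<le> u ^ 4" by (intro power_increasing) auto
    with u show ?thesis by linarith
  qed
  then have "(u\<^sup>2 - u ^ 4) * \<mu> \<le> u * \<mu>" using assms by (intro mult_right_mono) auto
  moreover have "s\<^sup>2 = u\<^sup>2 * \<mu>\<^sup>2" "s ^ 4 = u ^ 4 * \<mu> ^ 4"
    using s by (metis power2_abs power_mult_distrib, metis power_even_abs_numeral power_mult_distrib even_numeral)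
  moreover have "u\<^sup>2 * \<mu>\<^sup>2 / \<mu> - u ^ 4 * \<mu> ^ 4 / \<mu> ^ 3 = (u\<^sup>2 - u ^ 4) * \<mu>"
    using assms by (simp add: field_simps power2_eq_square power3_eq_cube power4_eq_xxxx)
  ultimately show ?thesis using s by simp
qed

section \<open>The random environment\<close>

text \<open>Indexing \<open>F\<close> and \<open>B\<close> jointly by \<open>int + int\<close>
  expresses independence within each family and between the two families in a single
  \<open>indep_vars\<close>.\<close>

locale random_environment = prob_space M for M :: "'a measure" +
  fixes F B :: "int \<Rightarrow> 'a \<Rightarrow> real" and \<rho> :: "real \<Rightarrow> real" and c :: real
  assumes c_pos: "c > 0"
    and indep: "indep_vars (\<lambda>_. borel)
                  (\<lambda>j. case j of Inl x \<Rightarrow> F x | Inr i \<Rightarrow> B i) (UNIV :: (int + int) set)"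
    and B_plus: "\<And>i. measure M {\<omega> \<in> space M. B i \<omega> = 1} = 1/2"
    and B_minus: "\<And>i. measure M {\<omega> \<in> space M. B i \<omega> = -1} = 1/2"
    and F_dens: "\<And>x. distributed M lborel (F x) (\<lambda>t. ennreal (\<rho> t))"
    and rho_even: "\<And>t. \<rho> (-t) = \<rho> t"
    and rho_pos: "\<And>t. -c < t \<Longrightarrow> t < c \<Longrightarrow> \<rho> t > 0"
    and rho_zero: "\<And>t. \<bar>t\<bar> \<ge> c \<Longrightarrow> \<rho> t = 0"
begin

section \<open>Almost sure bounds and first moments\<close>

abbreviation Z :: "int + int \<Rightarrow> 'a \<Rightarrow> real" where
  "Z j \<equiv> case j of Inl x \<Rightarrow> F x | Inr i \<Rightarrow> B i"

lemma rv_Z: "Z j \<in> borel_measurable M"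
  using indep unfolding indep_vars_def2 by blast

lemma rv_F [measurable]: "F x \<in> borel_measurable M"
  using rv_Z[of "Inl x"] by simp

lemma rv_B [measurable]: "B i \<in> borel_measurable M"
  using rv_Z[of "Inr i"] by simp

lemma F_gen_alg: "Inl x \<in> J \<Longrightarrow> F x \<in> borel_measurable (gen_alg Z J)"
  using measurable_gen_alg[of "Inl x" J Z] by simp

lemma B_gen_alg: "Inr i \<in> J \<Longrightarrow> B i \<in> borel_measurable (gen_alg Z J)"
  using measurable_gen_alg[of "Inr i" J Z] by simp

lemma expectation_mult_disjoint:
  fixes f g :: "'a \<Rightarrow> real"
  assumes "f \<in> borel_measurable (gen_alg Z J)" "g \<in> borel_measurable (gen_alg Z K)" "J \<inter> K = {}"
    and "integrable M f" "integrable M g"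
  shows "expectation (\<lambda>\<omega>. f \<omega> * g \<omega>) = expectation f * expectation g"
  by (rule indep_var_lebesgue_integral[OF _ assms(4,5)])
    (rule indep_var_gen_alg[OF indep assms(3) _ _ assms(1,2)], auto)

lemma rho_nonneg: "0 \<le> \<rho> t"
  using rho_pos[of t] rho_zero[of t] by fastforce

lemma AE_B: "AE \<omega> in M. \<forall>i. B i \<omega> = 1 \<or> B i \<omega> = - 1"
proof -
  have "AE \<omega> in M. B i \<omega> = 1 \<or> B i \<omega> = - 1" for i
  proof -
    have "prob ({\<omega> \<in> space M. B i \<omega> = 1} \<union> {\<omega> \<in> space M. B i \<omega> = - 1})
        = prob {\<omega> \<in> space M. B i \<omega> = 1} + prob {\<omega> \<in> space M. B i \<omega> = - 1}"
      by (intro finite_measure_Union) auto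
    then have "prob {\<omega> \<in> space M. B i \<omega> = 1 \<or> B i \<omega> = - 1} = 1"
      unfolding B_plus B_minus by (simp add: Un_def conj_disj_distribL[symmetric] Collect_disj_eq[symmetric])
    then show ?thesis by (simp add: prob_Collect_eq_1)
  qed
  then show ?thesis by (simp add: AE_all_countable)
qed

text \<open>The density is positive exactly on the open interval from \<open>- c\<close> to
  \<open>c\<close>, so the law of \<open>F x\<close> and Lebesgue measure on that interval have the
  same null sets.\<close>

lemma AE_F_iff:
  assumes "Measurable.pred borel P"
  shows "(AE \<omega> in M. P (F x \<omega>)) \<longleftrightarrow> (AE t in lborel. \<bar>t\<bar> < c \<longrightarrow> P t)"
proof -
  have "0 < ennreal (\<rho> t) \<longleftrightarrow> \<bar>t\<bar> < c" for t
    using rho_pos[of t] rho_zero[of t] by (cases "\<bar>t\<bar> < c") auto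
  then show ?thesis
    using distributed_AE2[OF F_dens[of x], of P] assms by simp
qed

lemma AE_F: "AE \<omega> in M. \<forall>x. \<bar>F x \<omega>\<bar> < c"
proof -
  have "AE \<omega> in M. \<bar>F x \<omega>\<bar> < c" for x
    by (subst AE_F_iff) auto
  then show ?thesis by (simp add: AE_all_countable)
qed

lemma AE_bounds: "AE \<omega> in M. (\<forall>x. \<bar>F x \<omega>\<bar> < c) \<and> (\<forall>i. B i \<omega> = 1 \<or> B i \<omega> = - 1)"
  using AE_F AE_B by eventually_elim blast

lemma expectation_F: "expectation (\<lambda>\<omega>. g (F x \<omega>)) = (\<integral>t. \<rho> t * g t \<partial>lborel)"
  if "g \<in> borel_measurable borel" for g :: "real \<Rightarrow> real"
  using distributed_integral[OF F_dens[of x], of g] that rho_nonneg by simp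

lemma mean_F: "expectation (F x) = 0"
proof -
  have "expectation (F x) = (\<integral>t. \<rho> t * t \<partial>lborel)"
    using expectation_F[of "\<lambda>t. t" x] by simp
  \<comment> \<open>Substitute \<open>- t\<close> for \<open>t\<close> and use that the density is
    even.\<close>
  moreover have "(\<integral>t. \<rho> t * t \<partial>lborel) = - (\<integral>t. \<rho> t * t \<partial>lborel)"
    by (subst lborel_integral_real_affine[where c="-1" and t=0]) (simp_all add: rho_even)
  ultimately show ?thesis by simp
qed

lemma mean_B: "expectation (B i) = 0"
proof -
  have "expectation (B i) = expectation (\<lambda>\<omega>. indicator {\<omega> \<in> space M. B i \<omega> = 1} \<omega>
      - indicator {\<omega> \<in> space M. B i \<omega> = - 1} \<omega>)"
    by (rule integral_cong_AE) (use AE_B in \<open>auto elim!: eventually_mono simp: indicator_def\<close>)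
  also have "\<dots> = 0"
    by (subst Bochner_Integration.integral_diff)
      (auto simp: B_plus B_minus less_top[symmetric] intro!: integrable_real_indicator)
  finally show ?thesis .
qed

lemma integrable_F: "integrable M (F x)"
  by (rule integrable_const_bound[where B=c]) (use AE_F in \<open>auto elim!: eventually_mono intro: less_imp_le\<close>)

lemma integrable_B: "integrable M (B i)"
  by (rule integrable_const_bound[where B=1]) (use AE_B in \<open>auto elim!: eventually_mono dest!: spec[of _ i]\<close>)

lemma mean_BF: "expectation (\<lambda>\<omega>. B i \<omega> * F x \<omega>) = 0"
  using expectation_mult_disjoint[of "B i" "{Inr i}" "F x" "{Inl x}"]
  by (simp add: B_gen_alg F_gen_alg integrable_B integrable_F mean_F)

lemma integrable_BF: "integrable M (\<lambda>\<omega>. B i \<omega> * F x \<omega>)"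
  by (rule integrable_const_bound[where B=c], rule eventually_mono[OF AE_bounds])
    (auto simp: abs_mult less_imp_le dest!: spec[where x=i and P="\<lambda>i. B i _ = 1 \<or> B i _ = - 1"])

text \<open>Strictness comes from the strict almost sure bound; it makes the constant
  \<open>K\<close> of the theorem positive.\<close>

lemma mean_abs_F_less: "expectation (\<lambda>\<omega>. \<bar>F x \<omega>\<bar>) < c"
  by (rule expectation_less) (use AE_F in \<open>auto intro!: integrable_abs integrable_F elim!: eventually_mono\<close>)

lemma AE_F_sq_le: "AE \<omega> in M. (F x \<omega>)\<^sup>2 \<le> c\<^sup>2"
  using AE_F c_pos by (auto elim!: eventually_mono simp: abs_le_square_iff[symmetric] intro: less_imp_le)

lemma integrable_F_sq: "integrable M (\<lambda>\<omega>. (F x \<omega>)\<^sup>2)"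
  by (rule integrable_const_bound[where B="c\<^sup>2"]) (use AE_F_sq_le in auto)

lemma mean_F_sq_pos: "0 < expectation (\<lambda>\<omega>. (F x \<omega>)\<^sup>2)"
proof (rule expectation_greater)
  show "integrable M (\<lambda>\<omega>. (F x \<omega>)\<^sup>2)" by (rule integrable_F_sq)
  show "AE \<omega> in M. 0 < (F x \<omega>)\<^sup>2"
    by (subst AE_F_iff) (use AE_lborel_singleton[of 0] in \<open>auto elim!: eventually_mono\<close>)
qed

text \<open>If the probability vanished, \<open>AE_F_iff\<close> would make a nonempty open interval
  Lebesgue null.\<close>

lemma prob_F_pos:
  assumes "-c \<le> a" "a < b" "b \<le> c"
  shows "0 < prob {\<omega>\<in>space M. F x \<omega> \<in> {a<..<b}}"
proof (rule ccontr)
  assume "\<not> ?thesis"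
  then have "prob {\<omega>\<in>space M. F x \<omega> \<in> {a<..<b}} = 0"
    using measure_nonneg[of M] by (simp add: not_less order.antisym)
  then have "AE \<omega> in M. \<not> F x \<omega> \<in> {a<..<b}"
    by (subst (asm) prob_Collect_eq_0) auto
  then have "AE t in lborel. \<bar>t\<bar> < c \<longrightarrow> \<not> t \<in> {a<..<b}"
    by (subst (asm) AE_F_iff) auto
  then have "AE t in lborel. \<not> t \<in> {a<..<b}"
    by (rule eventually_mono) (use assms in auto)
  then have "emeasure lborel {a<..<b} = 0"
    by (subst (asm) AE_iff_measurable[where N="{a<..<b}"]) auto
  then show False using assms by simp
qed

section \<open>Existence of traps\<close>

text \<open>A walk that has reached such a pair of neighbouring sites can collect less than \<open>-b\<close> at every
  step by choosing the site according to the sign of \<open>B\<close>.\<close>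
lemma AE_exists_trap:
  assumes "-c \<le> b" "b < c"
  shows "AE \<omega> in M. \<exists>x::nat. b < F (int x) \<omega> \<and> F (int x + 1) \<omega> < - b"
proof -
  define u :: "real \<Rightarrow> real" where "u = indicator {b<..<c}"
  define w :: "real \<Rightarrow> real" where "w = indicator {-c<..<-b}"
  define p where "p = (\<integral>t. \<rho> t * u t \<partial>lborel) * (\<integral>t. \<rho> t * w t \<partial>lborel)"
  \<comment> \<open>\<open>g j\<close> is the indicator that the pair of sites \<open>2 j\<close>,
    \<open>2 j + 1\<close> is not a trap. These pairs are disjoint, so the \<open>g j\<close> are
    independent, each with mean \<open>1 - p\<close>.\<close>
  define g where "g j \<omega> = 1 - u (F (2 * int j) \<omega>) * w (F (2 * int j + 1) \<omega>)" for j \<omega>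
  have [measurable]: "u \<in> borel_measurable borel" "w \<in> borel_measurable borel"
    by (simp_all add: u_def w_def)
  have uw: "0 \<le> u t" "u t \<le> 1" "0 \<le> w t" "w t \<le> 1" for t
    by (simp_all add: u_def w_def)
  have g01: "0 \<le> g j \<omega>" "g j \<omega> \<le> 1" for j \<omega>
    unfolding g_def using uw mult_le_one[OF uw(2) uw(3,4)] by auto
  have int_u: "integrable M (\<lambda>\<omega>. u (F x \<omega>))" and int_w: "integrable M (\<lambda>\<omega>. w (F x \<omega>))" for x
    using uw by (auto intro!: integrable_const_bound[where B=1])
  have pos: "0 < expectation (\<lambda>\<omega>. u (F x \<omega>))" "0 < expectation (\<lambda>\<omega>. w (F x \<omega>))" for x
  proof -
    have *: "expectation (\<lambda>\<omega>. indicat_real A (F x \<omega>)) = prob {\<omega>\<in>space M. F x \<omega> \<in> A}"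
      if [measurable]: "A \<in> sets borel" for A :: "real set"
    proof -
      have "expectation (\<lambda>\<omega>. indicat_real A (F x \<omega>)) = expectation (indicat_real {\<omega>\<in>space M. F x \<omega> \<in> A})"
        by (intro Bochner_Integration.integral_cong) (auto simp: indicator_def)
      then show ?thesis by simp
    qed
    show "0 < expectation (\<lambda>\<omega>. u (F x \<omega>))" "0 < expectation (\<lambda>\<omega>. w (F x \<omega>))"
      unfolding u_def w_def using prob_F_pos[of b c x] prob_F_pos[of "-c" "-b" x] assms by (simp_all add: *)
  qed
  have p_pos: "0 < p"
    unfolding p_def using pos[of 0] by (simp add: expectation_F)
  have Eg: "expectation (g j) = 1 - p" for j
  proof -
    have "expectation (\<lambda>\<omega>. u (F (2 * int j) \<omega>) * w (F (2 * int j + 1) \<omega>)) = p"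
      unfolding p_def
      by (subst expectation_mult_disjoint[where J="{Inl (2 * int j)}" and K="{Inl (2 * int j + 1)}"])
        (auto intro!: int_u int_w measurable_compose[OF F_gen_alg] simp: expectation_F)
    moreover have "integrable M (\<lambda>\<omega>. u (F (2 * int j) \<omega>) * w (F (2 * int j + 1) \<omega>))"
      using uw mult_le_one[OF uw(2) uw(3,4)] by (intro integrable_const_bound[where B=1]) auto
    ultimately show ?thesis
      unfolding g_def by (subst Bochner_Integration.integral_diff) (auto simp: prob_space)
  qed
  have g_gen: "g j \<in> borel_measurable (gen_alg Z K)"
    if "{Inl (2 * int j), Inl (2 * int j + 1)} \<subseteq> K" for j K
    unfolding g_def
    by (intro borel_measurable_diff borel_measurable_times borel_measurable_const
          measurable_compose[OF F_gen_alg]) (use that in auto)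
  have [measurable]: "g j \<in> borel_measurable M" for j
    unfolding g_def by measurable
  have int_prod: "integrable M (\<lambda>\<omega>. \<Prod>j<N. g j \<omega>)" for N
  proof (rule integrable_const_bound[where B=1])
    have "0 \<le> (\<Prod>j<N. g j \<omega>)" "(\<Prod>j<N. g j \<omega>) \<le> 1" for \<omega>
      using g01 by (simp_all add: prod_nonneg prod_le_1)
    then show "AE \<omega> in M. norm (\<Prod>j<N. g j \<omega>) \<le> 1" by simp
  qed measurable
  have EP: "expectation (\<lambda>\<omega>. \<Prod>j<N. g j \<omega>) = (1 - p) ^ N" for N
  proof (induction N)
    case (Suc N)
    have "expectation (\<lambda>\<omega>. (\<Prod>j<N. g j \<omega>) * g N \<omega>)
        = expectation (\<lambda>\<omega>. \<Prod>j<N. g j \<omega>) * expectation (g N)"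
    proof (rule expectation_mult_disjoint)
      \<comment> \<open>The first \<open>N\<close> factors use only sites below \<open>2 N\<close>,
        hence are independent of the pair used by \<open>g N\<close>.\<close>
      show "(\<lambda>\<omega>. \<Prod>j<N. g j \<omega>) \<in> borel_measurable (gen_alg Z (Inl ` {..<2 * int N}))"
        by (intro borel_measurable_prod g_gen) auto
      show "g N \<in> borel_measurable (gen_alg Z {Inl (2 * int N), Inl (2 * int N + 1)})"
        by (rule g_gen) simp
      show "integrable M (g N)"
        using g01 by (auto intro!: integrable_const_bound[where B=1])
    qed (auto intro: int_prod)
    then show ?case using Suc Eg[of N] by (simp add: mult.commute)
  qed (simp add: prob_space)
  have p_le: "p \<le> 1"
  proof -
    have "0 \<le> expectation (g 0)" using g01 by (intro integral_nonneg_AE) auto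
    then show ?thesis using Eg[of 0] by simp
  qed
  define A where "A = {\<omega>\<in>space M. \<not> (\<exists>x::nat. b < F (int x) \<omega> \<and> F (int x + 1) \<omega> < - b)}"
  have [measurable]: "A \<in> sets M" unfolding A_def by measurable
  \<comment> \<open>Without any trap all factors equal 1, so the indicator of \<open>A\<close> is
    below the product for every \<open>N\<close>.\<close>
  have "prob A \<le> (1 - p) ^ N" for N
  proof -
    have "prob A = expectation (indicator A)" by simp
    also have "\<dots> \<le> expectation (\<lambda>\<omega>. \<Prod>j<N. g j \<omega>)"
    proof (rule integral_mono)
      fix \<omega> assume "\<omega> \<in> space M"
      have "g j \<omega> = 1" if "\<omega> \<in> A" for j
      proof -
        have "\<not> (b < F (int (2 * j)) \<omega> \<and> F (int (2 * j) + 1) \<omega> < - b)"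
          using that unfolding A_def by blast
        then show ?thesis by (auto simp: g_def u_def w_def indicator_def)
      qed
      then show "indicator A \<omega> \<le> (\<Prod>j<N. g j \<omega>)"
        using g01 by (auto simp: indicator_def intro!: prod_nonneg)
    qed (auto intro!: integrable_real_indicator int_prod simp: less_top[symmetric])
    finally show ?thesis by (simp add: EP)
  qed
  moreover have "(\<lambda>N. (1 - p) ^ N) \<longlonglongrightarrow> 0"
    using p_pos p_le by (intro LIMSEQ_realpow_zero) auto
  ultimately have "prob A \<le> 0"
    using LIMSEQ_le_const[of "\<lambda>N. (1 - p) ^ N" 0 "prob A"] by blast
  then have "prob {\<omega>\<in>space M. \<not> (\<exists>x::nat. b < F (int x) \<omega> \<and> F (int x + 1) \<omega> < - b)} = 0"
    unfolding A_def by (simp add: order.antisym)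
  then show ?thesis by (subst (asm) prob_Collect_eq_0) auto
qed

section \<open>Moments of the gain\<close>

text \<open>The difference between the actions of a block whose single pause is made at the start and at
  the end; see \<open>pause_first_diff_pause_last\<close>.\<close>
definition gain :: "int \<Rightarrow> int \<Rightarrow> nat \<Rightarrow> 'a \<Rightarrow> real" where
  "gain t x k \<omega> = (\<Sum>i<k. B (t + int i) \<omega> * (F (x + int i) \<omega> - F (x + int i + 1) \<omega>))"

lemma gain_measurable [measurable]: "gain t x k \<in> borel_measurable M"
  unfolding gain_def by measurable

lemma AE_gain_le: "AE \<omega> in M. \<forall>t x k. \<bar>gain t x k \<omega>\<bar> \<le> 2 * c * real k"
  using AE_bounds
proof eventually_elim
  case (elim \<omega>)
  show ?case
  proof (intro allI)
    fix t x k
    have "\<bar>gain t x k \<omega>\<bar> \<le> (\<Sum>i<k. 2 * c)"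
      unfolding gain_def
    proof (rule order_trans[OF sum_abs sum_mono])
      fix i
      have "\<bar>B (t + int i) \<omega>\<bar> = 1" using elim by (metis abs_1 abs_minus_cancel)
      moreover have "\<bar>F (x + int i) \<omega>\<bar> < c" "\<bar>F (x + int i + 1) \<omega>\<bar> < c" using elim by auto
      ultimately show "\<bar>B (t + int i) \<omega> * (F (x + int i) \<omega> - F (x + int i + 1) \<omega>)\<bar> \<le> 2 * c"
        by (simp add: abs_mult)
    qed
    then show "\<bar>gain t x k \<omega>\<bar> \<le> 2 * c * real k" by (simp add: mult.commute)
  qed
qed

text \<open>The free exponents cover all mixed moments in the expansions below; exponent 0 yields
  pure powers of either factor.\<close>

lemma integrable_gain_mult:
  "integrable M (\<lambda>\<omega>. gain t x k \<omega> ^ p * (F y \<omega> - F z \<omega>) ^ q)"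
proof (rule integrable_const_bound[where B="(2 * c * real k) ^ p * (2 * c) ^ q"])
  show "AE \<omega> in M. norm (gain t x k \<omega> ^ p * (F y \<omega> - F z \<omega>) ^ q) \<le> (2 * c * real k) ^ p * (2 * c) ^ q"
    using AE_gain_le AE_F
  proof eventually_elim
    case (elim \<omega>)
    have "\<bar>F y \<omega> - F z \<omega>\<bar> \<le> 2 * c"
      using elim(2)[rule_format, of y] elim(2)[rule_format, of z] by linarith
    then show ?case
      using elim(1) c_pos unfolding real_norm_def abs_mult power_abs by (intro mult_mono power_mono) auto
  qed
qed measurable

text \<open>\<open>gain t x k\<close> uses only signs with index below \<open>t + int k\<close>, so
  the next sign is independent of it and of every \<open>F\<close>, and has mean 0. This kills all
  terms that are odd in the new sign.\<close>

lemma expectation_gain_mult_B: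
  "expectation (\<lambda>\<omega>. gain t x k \<omega> ^ p * (F y \<omega> - F z \<omega>) ^ q * B (t + int k) \<omega>) = 0"
proof -
  have "expectation (\<lambda>\<omega>. (gain t x k \<omega> ^ p * (F y \<omega> - F z \<omega>) ^ q) * B (t + int k) \<omega>)
      = expectation (\<lambda>\<omega>. gain t x k \<omega> ^ p * (F y \<omega> - F z \<omega>) ^ q) * expectation (B (t + int k))"
  proof (rule expectation_mult_disjoint)
    show "(\<lambda>\<omega>. gain t x k \<omega> ^ p * (F y \<omega> - F z \<omega>) ^ q)
        \<in> borel_measurable (gen_alg Z (range Inl \<union> Inr ` {..<t + int k}))"
      unfolding gain_def
      by (intro borel_measurable_times borel_measurable_power borel_measurable_sum
          borel_measurable_diff F_gen_alg B_gen_alg) auto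
    show "B (t + int k) \<in> borel_measurable (gen_alg Z {Inr (t + int k)})"
      by (rule B_gen_alg) simp
  qed (auto intro: integrable_gain_mult integrable_B)
  then show ?thesis by (simp add: mean_B)
qed

lemma integrable_gain_mult_B:
  "integrable M (\<lambda>\<omega>. gain t x k \<omega> ^ p * (F y \<omega> - F z \<omega>) ^ q * B i \<omega>)"
proof (rule Bochner_Integration.integrable_bound[OF integrable_gain_mult[of t x k p y z q]])
  show "AE \<omega> in M. norm (gain t x k \<omega> ^ p * (F y \<omega> - F z \<omega>) ^ q * B i \<omega>)
      \<le> norm (gain t x k \<omega> ^ p * (F y \<omega> - F z \<omega>) ^ q)"
    using AE_B
  proof eventually_elim
    case (elim \<omega>)
    then have "\<bar>B i \<omega>\<bar> = 1" by (metis abs_1 abs_minus_cancel)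
    then show ?case by (simp add: abs_mult)
  qed
qed measurable

text \<open>In the square of \<open>gain + b * G\<close> the cross term has mean 0 and
  \<open>b\<^sup>2 = 1\<close>, so each step adds the second moment of \<open>G\<close>. That is
  twice the second moment of \<open>F 0\<close>, since neighbouring values of \<open>F\<close> are
  independent and centred.\<close>

lemma expectation_gain_sq:
  "expectation (\<lambda>\<omega>. (gain t x k \<omega>)\<^sup>2) = 2 * expectation (\<lambda>\<omega>. (F 0 \<omega>)\<^sup>2) * real k"
proof (induction k)
  case (Suc k)
  let ?G = "\<lambda>\<omega>. F (x + int k) \<omega> - F (x + int k + 1) \<omega>" and ?b = "B (t + int k)"
  have FF: "integrable M (\<lambda>\<omega>. F y \<omega> * F z \<omega>)" for y z
    by (rule integrable_const_bound[where B="c * c"], rule eventually_mono[OF AE_F])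
      (auto simp: abs_mult intro!: mult_mono intro: less_imp_le)
  have cross: "expectation (\<lambda>\<omega>. F (x + int k) \<omega> * F (x + int k + 1) \<omega>) = 0"
    by (subst expectation_mult_disjoint[where J="{Inl (x + int k)}" and K="{Inl (x + int k + 1)}"])
      (auto intro: F_gen_alg integrable_F simp: mean_F)
  have sq: "expectation (\<lambda>\<omega>. (F y \<omega>)\<^sup>2) = expectation (\<lambda>\<omega>. (F 0 \<omega>)\<^sup>2)" for y
    by (simp add: expectation_F[of "\<lambda>t. t\<^sup>2"])
  have "(\<lambda>\<omega>. (?G \<omega>)\<^sup>2) = (\<lambda>\<omega>. (F (x + int k) \<omega>)\<^sup>2 + (F (x + int k + 1) \<omega>)\<^sup>2
      - 2 * (F (x + int k) \<omega> * F (x + int k + 1) \<omega>))"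
    by (auto simp: power2_eq_square algebra_simps)
  then have G2: "expectation (\<lambda>\<omega>. (?G \<omega>)\<^sup>2) = 2 * expectation (\<lambda>\<omega>. (F 0 \<omega>)\<^sup>2)"
    using integrable_F_sq FF cross sq[of "x + int k"] sq[of "x + int k + 1"] by simp
  have "expectation (\<lambda>\<omega>. (gain t x (Suc k) \<omega>)\<^sup>2)
      = expectation (\<lambda>\<omega>. (gain t x k \<omega>)\<^sup>2 + 2 * (gain t x k \<omega> ^ 1 * ?G \<omega> ^ 1 * ?b \<omega>) + (?G \<omega>)\<^sup>2)"
  proof (rule integral_cong_AE)
    show "AE \<omega> in M. (gain t x (Suc k) \<omega>)\<^sup>2
        = (gain t x k \<omega>)\<^sup>2 + 2 * (gain t x k \<omega> ^ 1 * ?G \<omega> ^ 1 * ?b \<omega>) + (?G \<omega>)\<^sup>2"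
      using AE_B
    proof eventually_elim
      case (elim \<omega>)
      have "gain t x (Suc k) \<omega> = gain t x k \<omega> + ?b \<omega> * ?G \<omega>" by (simp add: gain_def)
      moreover have "?b \<omega> = 1 \<or> ?b \<omega> = -1" using elim by blast
      then have "(?b \<omega>)\<^sup>2 = 1" by auto
      then have "(gain t x k \<omega> + ?b \<omega> * ?G \<omega>)\<^sup>2
          = (gain t x k \<omega>)\<^sup>2 + 2 * (gain t x k \<omega> ^ 1 * ?G \<omega> ^ 1 * ?b \<omega>) + (?G \<omega>)\<^sup>2"
        by (simp only: power2_sum power_mult_distrib power_one_right mult_1 mult_ac)
      ultimately show ?case by simp
    qed
  qed measurable
  also have "\<dots> = expectation (\<lambda>\<omega>. (gain t x k \<omega>)\<^sup>2) + expectation (\<lambda>\<omega>. (?G \<omega>)\<^sup>2)"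
    using integrable_gain_mult[of t x k 2 0 0 0] integrable_gain_mult[of t x k 0 "x + int k" "x + int k + 1" 2]
      integrable_gain_mult_B[of t x k 1 "x + int k" "x + int k + 1" 1 "t + int k"]
      expectation_gain_mult_B[of t x k 1 "x + int k" "x + int k + 1" 1]
    by simp
  finally show ?case using Suc G2 by (simp add: algebra_simps)
qed (simp add: gain_def)

text \<open>Only even powers of the new sign survive. Bounding the increment by \<open>2 * c\<close>
  turns the factor 6 into \<open>24 * c\<^sup>2\<close> and adds \<open>16 * c ^ 4\<close>; as the
  second moment is linear in \<open>k\<close>, the recursion grows quadratically, and 48 is large
  enough to close the induction.\<close>

lemma expectation_gain_pow4:
  "expectation (\<lambda>\<omega>. gain t x k \<omega> ^ 4) \<le> 48 * c ^ 4 * (real k)\<^sup>2"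
proof (induction k)
  case (Suc k)
  let ?G = "\<lambda>\<omega>. F (x + int k) \<omega> - F (x + int k + 1) \<omega>" and ?b = "B (t + int k)"
  note int = integrable_gain_mult[of t x k _ "x + int k" "x + int k + 1"]
  note intB = integrable_gain_mult_B[of t x k _ "x + int k" "x + int k + 1" _ "t + int k"]
  note zero = expectation_gain_mult_B[of t x k _ "x + int k" "x + int k + 1"]
  have "expectation (\<lambda>\<omega>. gain t x (Suc k) \<omega> ^ 4)
      \<le> expectation (\<lambda>\<omega>. gain t x k \<omega> ^ 4 + 4 * (gain t x k \<omega> ^ 3 * ?G \<omega> ^ 1 * ?b \<omega>)
        + 24 * c\<^sup>2 * (gain t x k \<omega>)\<^sup>2 + 4 * (gain t x k \<omega> ^ 1 * ?G \<omega> ^ 3 * ?b \<omega>) + 16 * c ^ 4)"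
  proof (rule integral_mono_AE)
    show "integrable M (\<lambda>\<omega>. gain t x (Suc k) \<omega> ^ 4)"
      using integrable_gain_mult[of t x "Suc k" 4 0 0 0] by simp
    show "integrable M (\<lambda>\<omega>. gain t x k \<omega> ^ 4 + 4 * (gain t x k \<omega> ^ 3 * ?G \<omega> ^ 1 * ?b \<omega>)
        + 24 * c\<^sup>2 * (gain t x k \<omega>)\<^sup>2 + 4 * (gain t x k \<omega> ^ 1 * ?G \<omega> ^ 3 * ?b \<omega>) + 16 * c ^ 4)"
      using int[of 4 0] int[of 2 0] intB[of 3 1] intB[of 1 3]
      by (intro Bochner_Integration.integrable_add integrable_mult_right) auto
    show "AE \<omega> in M. gain t x (Suc k) \<omega> ^ 4
        \<le> gain t x k \<omega> ^ 4 + 4 * (gain t x k \<omega> ^ 3 * ?G \<omega> ^ 1 * ?b \<omega>)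
        + 24 * c\<^sup>2 * (gain t x k \<omega>)\<^sup>2 + 4 * (gain t x k \<omega> ^ 1 * ?G \<omega> ^ 3 * ?b \<omega>) + 16 * c ^ 4"
      using AE_bounds
    proof eventually_elim
      case (elim \<omega>)
      define X g b where "X = gain t x k \<omega>" and "g = ?G \<omega>" and "b = ?b \<omega>"
      have "b = 1 \<or> b = -1" using elim by (simp add: b_def)
      then have "b\<^sup>2 = 1" "b ^ 3 = b" "b ^ 4 = 1" by auto
      moreover have "(X + b * g) ^ 4
          = X ^ 4 + 4 * (X ^ 3 * g * b) + 6 * (X\<^sup>2 * g\<^sup>2) * b\<^sup>2 + 4 * (X * g ^ 3) * b ^ 3 + g ^ 4 * b ^ 4"
        by algebra
      ultimately have expand: "(X + b * g) ^ 4
          = X ^ 4 + 4 * (X ^ 3 * g * b) + 6 * (X\<^sup>2 * g\<^sup>2) + 4 * (X * g ^ 3 * b) + g ^ 4"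
        by simp
      have "\<bar>g\<bar> \<le> \<bar>2 * c\<bar>"
        using elim[THEN conjunct1, rule_format, of "x + int k"]
          elim[THEN conjunct1, rule_format, of "x + int k + 1"] unfolding g_def by linarith
      then have g2: "g\<^sup>2 \<le> 4 * c\<^sup>2"
        using abs_le_square_iff[of g "2 * c"] by (simp add: power_mult_distrib)
      then have "(g\<^sup>2)\<^sup>2 \<le> (4 * c\<^sup>2)\<^sup>2" by (intro power_mono) auto
      then have "g ^ 4 \<le> 16 * c ^ 4" by (simp add: power_mult_distrib power_mult[symmetric])
      moreover have "X\<^sup>2 * g\<^sup>2 \<le> X\<^sup>2 * (4 * c\<^sup>2)" using g2 by (intro mult_left_mono) auto
      ultimately have "(X + b * g) ^ 4
          \<le> X ^ 4 + 4 * (X ^ 3 * g ^ 1 * b) + 24 * c\<^sup>2 * X\<^sup>2 + 4 * (X ^ 1 * g ^ 3 * b) + 16 * c ^ 4"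
        unfolding expand by (simp add: mult_ac)
      moreover have "gain t x (Suc k) \<omega> = X + b * g" by (simp add: gain_def X_def b_def g_def)
      ultimately show ?case unfolding X_def b_def g_def by simp
    qed
  qed
  also have "\<dots> = expectation (\<lambda>\<omega>. gain t x k \<omega> ^ 4)
      + 24 * c\<^sup>2 * expectation (\<lambda>\<omega>. (gain t x k \<omega>)\<^sup>2) + 16 * c ^ 4"
    using int[of 4 0] int[of 2 0] intB[of 3 1] intB[of 1 3] zero[of 3 1] zero[of 1 3]
    by (simp add: prob_space)
  also have "expectation (\<lambda>\<omega>. (gain t x k \<omega>)\<^sup>2) \<le> 2 * c\<^sup>2 * real k"
  proof -
    have "expectation (\<lambda>\<omega>. (F 0 \<omega>)\<^sup>2) \<le> c\<^sup>2"
      by (rule integral_le_const[OF integrable_F_sq AE_F_sq_le])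
    then show ?thesis unfolding expectation_gain_sq by (simp add: mult_right_mono)
  qed
  finally have "expectation (\<lambda>\<omega>. gain t x (Suc k) \<omega> ^ 4)
      \<le> 48 * c ^ 4 * (real k)\<^sup>2 + 24 * c\<^sup>2 * (2 * c\<^sup>2 * real k) + 16 * c ^ 4"
    using Suc by (simp add: mult_left_mono)
  also have "\<dots> = c ^ 4 * (48 * (real k)\<^sup>2 + 48 * real k + 16)"
    by algebra
  also have "\<dots> \<le> c ^ 4 * (48 * (real (Suc k))\<^sup>2)"
    by (intro mult_left_mono) (auto simp: power2_eq_square algebra_simps)
  finally show ?case by (simp add: mult_ac)
qed (simp add: gain_def)

text \<open>The moment estimates do not depend on \<open>t\<close> and \<open>x\<close>, so one
  block length serves all blocks.\<close>

lemma expectation_abs_gain_unbounded: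
  "\<exists>m>0. \<forall>t x. C \<le> expectation (\<lambda>\<omega>. \<bar>gain t x m \<omega>\<bar>)"
proof -
  define v where "v = expectation (\<lambda>\<omega>. (F 0 \<omega>)\<^sup>2)"
  have v: "0 < v" unfolding v_def by (rule mean_F_sq_pos)
  \<comment> \<open>Block length \<open>r\<^sup>2\<close> and scale \<open>\<mu> = L * r\<close>
    give second-moment term \<open>2 * v * r / L\<close>. This \<open>L\<close> makes the
    fourth-moment term half of that, so \<open>v * r / L\<close> remains, which is unbounded in
    \<open>r\<close>.\<close>
  define L where "L = sqrt (48 * c ^ 4 / v)"
  have L: "0 < L" and L2: "L\<^sup>2 = 48 * c ^ 4 / v"
    using v c_pos by (auto simp: L_def)
  obtain r :: nat where r: "max 1 (C * L / v) \<le> real r" using real_arch_simple by blast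
  then have r0: "0 < real r" by simp
  define \<mu> where "\<mu> = L * real r"
  have lam: "0 < \<mu>" using L r0 by (simp add: \<mu>_def)
  have "C \<le> expectation (\<lambda>\<omega>. \<bar>gain t x (r\<^sup>2) \<omega>\<bar>)" for t x
  proof -
    have i2: "integrable M (\<lambda>\<omega>. (gain t x (r\<^sup>2) \<omega>)\<^sup>2)" and i4: "integrable M (\<lambda>\<omega>. gain t x (r\<^sup>2) \<omega> ^ 4)"
      and i1: "integrable M (\<lambda>\<omega>. gain t x (r\<^sup>2) \<omega>)"
      using integrable_gain_mult[of t x "r\<^sup>2" _ 0 0 0, simplified] integrable_gain_mult[of t x "r\<^sup>2" 1 0 0 0]
      by simp_all
    have "C \<le> v * real r / L"
      using r L v by (simp add: field_simps)
    also have "\<dots> = 2 * v * real (r\<^sup>2) / \<mu> - 48 * c ^ 4 * (real (r\<^sup>2))\<^sup>2 / \<mu> ^ 3"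
    proof -
      have "48 * c ^ 4 = v * L\<^sup>2" using L2 v by simp
      then show ?thesis unfolding \<mu>_def
        using L r0 by (simp add: field_simps power2_eq_square power3_eq_cube)
    qed
    also have "\<dots> \<le> expectation (\<lambda>\<omega>. (gain t x (r\<^sup>2) \<omega>)\<^sup>2) / \<mu> - expectation (\<lambda>\<omega>. gain t x (r\<^sup>2) \<omega> ^ 4) / \<mu> ^ 3"
      using expectation_gain_pow4[of t x "r\<^sup>2"] lam
      by (simp only: expectation_gain_sq v_def) (intro diff_left_mono divide_right_mono, auto)
    also have "\<dots> = expectation (\<lambda>\<omega>. (gain t x (r\<^sup>2) \<omega>)\<^sup>2 / \<mu> - gain t x (r\<^sup>2) \<omega> ^ 4 / \<mu> ^ 3)"
      using i2 i4 by simp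
    also have "\<dots> \<le> expectation (\<lambda>\<omega>. \<bar>gain t x (r\<^sup>2) \<omega>\<bar>)"
      using i1 i2 i4 abs_ge_sq_minus_pow4[OF lam] by (intro integral_mono) auto
    finally show ?thesis .
  qed
  then show ?thesis using r0 by (intro exI[of _ "r\<^sup>2"]) auto
qed

section \<open>The shape function\<close>

lemma shape_function_limit:
  assumes "is_shape_function M B F \<Lambda>" "\<alpha> \<in> {-1..1}"
  shows "AE \<omega> in M. (\<lambda>n. min_action (\<lambda>i. B i \<omega>) (\<lambda>x. F x \<omega>) n (round0 (\<alpha> * real n)) / real n)
           \<longlonglongrightarrow> - \<Lambda> \<alpha>"
proof -
  have "AE \<omega> in M. \<forall>\<alpha>\<in>{-1..1}.
      (\<lambda>n. min_action (\<lambda>i. B i \<omega>) (\<lambda>x. F x \<omega>) n (round0 (\<alpha> * real n)) / real n) \<longlonglongrightarrow> - \<Lambda> \<alpha>"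
    using assms(1) unfolding is_shape_function_def by blast
  then show ?thesis by (rule eventually_mono) (use assms(2) in blast)
qed

lemma shape_function_0_ge:
  assumes "is_shape_function M B F \<Lambda>"
  shows "c \<le> \<Lambda> 0"
\<comment> \<open>It suffices to treat each \<open>b\<close> below \<open>c\<close>. The trap
  position is random but finite and fixed as \<open>n\<close> grows, so the travel cost vanishes
  after division by \<open>n\<close>.\<close>
proof (rule dense_le_bounded[OF c_pos])
  fix b assume b: "0 < b" "b < c"
  have "AE \<omega> in M. \<exists>x::nat. b < F (int x) \<omega> \<and> F (int x + 1) \<omega> < - b"
    using b by (intro AE_exists_trap) auto
  with shape_function_limit[OF assms, of 0, simplified] AE_bounds
  have "AE \<omega> in M. b \<le> \<Lambda> 0"
  proof (eventually_elim)
    case (elim \<omega>)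
    then obtain x :: nat where x: "b < F (int x) \<omega>" "F (int x + 1) \<omega> < - b" by blast
    have "min_action (\<lambda>i. B i \<omega>) (\<lambda>x. F x \<omega>) n 0 / real n \<le> 2 * c * (2 * real x + 1) / real n - b"
      if n: "2 * x < n" for n
    proof -
      have "min_action (\<lambda>i. B i \<omega>) (\<lambda>x. F x \<omega>) n 0 \<le> 2 * c * (2 * real x + 1) - b * real n"
        using elim x n b by (intro min_action_trap_le) (auto intro: less_imp_le)
      then have "min_action (\<lambda>i. B i \<omega>) (\<lambda>x. F x \<omega>) n 0 / real n
          \<le> (2 * c * (2 * real x + 1) - b * real n) / real n"
        by (rule divide_right_mono) simp
      then show ?thesis using n by (simp add: diff_divide_distrib)
    qed
    then have ev: "eventually (\<lambda>n. min_action (\<lambda>i. B i \<omega>) (\<lambda>x. F x \<omega>) n 0 / real n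
        \<le> 2 * c * (2 * real x + 1) / real n - b) sequentially"
      using eventually_gt_at_top[of "2 * x"] by (rule eventually_mono[rotated])
    have lim: "(\<lambda>n. 2 * c * (2 * real x + 1) / real n - b) \<longlonglongrightarrow> 0 - b"
      by (intro tendsto_intros lim_const_over_n)
    have "- \<Lambda> 0 \<le> 0 - b"
      using elim(1) by (intro tendsto_le[OF _ lim _ ev]) (auto simp: round0_def)
    then show ?case by simp
  qed
  \<comment> \<open>The inequality does not involve \<open>\<omega>\<close>, so holding almost
    surely means holding.\<close>
  then show "b \<le> \<Lambda> 0" by simp
qed

lemma shape_function_le:
  assumes "is_shape_function M B F \<Lambda>" and \<alpha>: "0 \<le> \<alpha>" "\<alpha> \<le> 1"
  shows "\<Lambda> \<alpha> \<le> c - (c - expectation (\<lambda>\<omega>. \<bar>F 0 \<omega>\<bar>)) * \<alpha>"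
proof -
  define e where "e = expectation (\<lambda>\<omega>. \<bar>F 0 \<omega>\<bar>)"
  have e: "e < c" unfolding e_def by (rule mean_abs_F_less)
  define V where "V n \<omega> = ((\<Sum>x=1..\<lfloor>\<alpha> * real n\<rfloor>. c - \<bar>F x \<omega>\<bar>) - c * real n) / real n" for n \<omega>
  have r0: "round0 (\<alpha> * real n) = \<lfloor>\<alpha> * real n\<rfloor>" and r1: "0 \<le> \<lfloor>\<alpha> * real n\<rfloor>"
    and r2: "\<lfloor>\<alpha> * real n\<rfloor> \<le> int n" for n
  proof -
    show "round0 (\<alpha> * real n) = \<lfloor>\<alpha> * real n\<rfloor>" "0 \<le> \<lfloor>\<alpha> * real n\<rfloor>" using \<alpha> by (auto simp: round0_def)
    have "\<alpha> * real n \<le> real n" using \<alpha> by (simp add: mult_left_le_one_le)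
    then show "\<lfloor>\<alpha> * real n\<rfloor> \<le> int n" by linarith
  qed
  have "\<alpha> * (c - e) - c \<le> - \<Lambda> \<alpha>"
  proof (rule expectation_le_AE_limit[OF shape_function_limit[OF assms(1)], of \<alpha> V c])
    show "\<alpha> \<in> {-1..1}" using \<alpha> by simp
    show "V n \<in> borel_measurable M" for n unfolding V_def by measurable
    show "AE \<omega> in M. \<bar>V n \<omega>\<bar> \<le> c" for n
      using AE_F
    proof eventually_elim
      case (elim \<omega>)
      have "0 \<le> (\<Sum>x=1..\<lfloor>\<alpha> * real n\<rfloor>. c - \<bar>F x \<omega>\<bar>)"
        using elim by (intro sum_nonneg) (simp add: less_imp_le)
      moreover have "(\<Sum>x=1..\<lfloor>\<alpha> * real n\<rfloor>. c - \<bar>F x \<omega>\<bar>) \<le> (\<Sum>x=1..\<lfloor>\<alpha> * real n\<rfloor>. c)"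
        by (intro sum_mono) simp
      moreover have "(\<Sum>x=1..\<lfloor>\<alpha> * real n\<rfloor>. c) \<le> c * real n"
        using r1[of n] r2[of n] c_pos by (simp add: mult.commute mult_left_mono)
      ultimately have "\<bar>(\<Sum>x=1..\<lfloor>\<alpha> * real n\<rfloor>. c - \<bar>F x \<omega>\<bar>) - c * real n\<bar> \<le> c * real n"
        by linarith
      then show ?case
        unfolding V_def using c_pos by (cases "n = 0") (simp_all add: abs_divide divide_le_eq)
    qed
    show "AE \<omega> in M. V n \<omega> \<le> min_action (\<lambda>i. B i \<omega>) (\<lambda>x. F x \<omega>) n (round0 (\<alpha> * real n)) / real n" for n
      using AE_bounds
    proof eventually_elim
      case (elim \<omega>)
      have "\<bar>B i \<omega>\<bar> \<le> 1" for i using elim by (metis abs_1 abs_minus_cancel order_refl)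
      then have visited: "(\<Sum>x=1..\<gamma> n. c - \<bar>F x \<omega>\<bar>) - c * real n \<le> action (\<lambda>i. B i \<omega>) (\<lambda>x. F x \<omega>) n \<gamma>"
        if "lazy_walk n \<gamma>" "\<gamma> 0 = 0" for \<gamma>
        using that elim by (intro action_ge_visited) (auto simp: less_imp_le)
      have "(\<Sum>x=1..\<lfloor>\<alpha> * real n\<rfloor>. c - \<bar>F x \<omega>\<bar>) - c * real n
          \<le> min_action (\<lambda>i. B i \<omega>) (\<lambda>x. F x \<omega>) n \<lfloor>\<alpha> * real n\<rfloor>"
      proof (rule le_min_action)
        show "\<bar>\<lfloor>\<alpha> * real n\<rfloor>\<bar> \<le> int n" using r1[of n] r2[of n] by linarith
      qed (metis visited)
      then show ?case unfolding V_def r0 by (rule divide_right_mono) simp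
    qed
    show "(\<lambda>n. \<alpha> * (c - e) - c - (c - e) / real n) \<longlonglongrightarrow> \<alpha> * (c - e) - c"
      using tendsto_diff[OF tendsto_const lim_const_over_n[of "c - e"], of "\<alpha> * (c - e) - c"] by simp
    \<comment> \<open>Rounding down loses less than one site, hence the error
      \<open>(c - e) / real n\<close>. For \<open>n = 0\<close> this quotient is 0 by
      convention.\<close>
    show "\<alpha> * (c - e) - c - (c - e) / real n \<le> expectation (V n)" for n
    proof (cases "n = 0")
      case True
      have "\<alpha> * (c - e) \<le> 1 * c"
        using \<alpha> e by (intro mult_mono) (auto simp: e_def)
      moreover have "V 0 = (\<lambda>_. 0)" by (simp add: V_def fun_eq_iff)
      ultimately show ?thesis using True by simp
    next
      case False
      have "expectation (\<lambda>\<omega>. \<bar>F x \<omega>\<bar>) = e" for x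
        unfolding e_def using expectation_F[of abs] by simp
      then have "expectation (V n) = (real_of_int \<lfloor>\<alpha> * real n\<rfloor> * (c - e) - c * real n) / real n"
        unfolding V_def using r1[of n] integrable_F by (simp add: prob_space)
      also have "\<dots> \<ge> ((\<alpha> * real n - 1) * (c - e) - c * real n) / real n"
        using e by (intro divide_right_mono diff_right_mono mult_right_mono) linarith+
      finally show ?thesis using False by (simp add: field_simps)
    qed
  qed
  then show ?thesis by (simp add: e_def algebra_simps)
qed

text \<open>The only admissible walk is the diagonal, whose action is centred; this gives
  \<open>\<Lambda> 1 \<le> 0\<close>, and nonnegativity is part of being a shape function.\<close>

lemma shape_function_1:
  assumes "is_shape_function M B F \<Lambda>"
  shows "\<Lambda> 1 = 0"
proof -
  define V where "V n \<omega> = (\<Sum>i=1..n. B (int i) \<omega> * F (int i) \<omega>) / real n" for n \<omega>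
  have "0 \<le> - \<Lambda> 1"
  proof (rule expectation_le_AE_limit[OF shape_function_limit[OF assms], of 1 V c])
    show "V n \<in> borel_measurable M" for n unfolding V_def by measurable
    show "AE \<omega> in M. \<bar>V n \<omega>\<bar> \<le> c" for n
      using AE_bounds
    proof eventually_elim
      case (elim \<omega>)
      have "\<bar>\<Sum>i=1..n. B (int i) \<omega> * F (int i) \<omega>\<bar> \<le> (\<Sum>i=1..n. c)"
      proof (rule order_trans[OF sum_abs sum_mono])
        fix i
        have "\<bar>B (int i) \<omega>\<bar> = 1" using elim by (metis abs_1 abs_minus_cancel)
        then show "\<bar>B (int i) \<omega> * F (int i) \<omega>\<bar> \<le> c" using elim by (simp add: abs_mult less_imp_le)
      qed
      then show ?case
        unfolding V_def using c_pos by (cases "n = 0") (simp_all add: abs_divide divide_le_eq mult.commute)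
    qed
    show "AE \<omega> in M. V n \<omega> \<le> min_action (\<lambda>i. B i \<omega>) (\<lambda>x. F x \<omega>) n (round0 (1 * real n)) / real n" for n
    proof (rule AE_I2)
      fix \<omega>
      have "(\<Sum>i=1..n. B (int i) \<omega> * F (int i) \<omega>) \<le> min_action (\<lambda>i. B i \<omega>) (\<lambda>x. F x \<omega>) n (int n)"
        by (rule le_min_action) (auto simp: action_def lazy_walk_straight)
      then show "V n \<omega> \<le> min_action (\<lambda>i. B i \<omega>) (\<lambda>x. F x \<omega>) n (round0 (1 * real n)) / real n"
        unfolding V_def by (simp add: round0_def divide_right_mono)
    qed
    show "(\<lambda>_. 0) \<longlonglongrightarrow> (0::real)" by simp
    show "0 \<le> expectation (V n)" for n
      unfolding V_def using integrable_BF by (simp add: mean_BF)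
  qed simp
  moreover have "0 \<le> \<Lambda> 1" using assms unfolding is_shape_function_def by simp
  ultimately show ?thesis by simp
qed

lemma shape_function_exceeds_chord:
  assumes "is_shape_function M B F \<Lambda>"
  shows "\<exists>\<alpha>. 0 < \<alpha> \<and> \<alpha> < 1 \<and> c * (1 - \<alpha>) < \<Lambda> \<alpha>"
proof -
  \<comment> \<open>Any constant above \<open>2 * c\<close> would do: half of it is gained per block
    of \<open>Suc m\<close> steps, while the chord at \<open>\<alpha>\<close> equals
    \<open>c / real (Suc m)\<close>.\<close>
  obtain m where m: "0 < m" and gain: "\<And>t x. 3 * c \<le> expectation (\<lambda>\<omega>. \<bar>gain t x m \<omega>\<bar>)"
    using expectation_abs_gain_unbounded[of "3 * c"] by blast
  define \<alpha> where "\<alpha> = real m / real (Suc m)"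
  have \<alpha>: "0 < \<alpha>" "\<alpha> < 1" using m by (auto simp: \<alpha>_def)
  define p where "p j \<omega> = pause_first (\<lambda>i. B i \<omega>) (\<lambda>x. F x \<omega>) m (Suc m * j) (m * j)" for j \<omega>
  define q where "q j \<omega> = pause_last (\<lambda>i. B i \<omega>) (\<lambda>x. F x \<omega>) m (Suc m * j) (m * j)" for j \<omega>
  \<comment> \<open>Along multiples of the block length \<open>\<alpha> * n k\<close> is an integer
    and rounding disappears; \<open>Suc k\<close> keeps the time positive.\<close>
  define n where "n k = Suc m * Suc k" for k
  have n_pos: "0 < n k" for k by (simp add: n_def)
  \<comment> \<open>The block walk bounds the minimal action from above, so the limit lemma is
    applied to the negated actions.\<close>
  define V where "V k \<omega> = - (\<Sum>j<Suc k. min (p j \<omega>) (q j \<omega>)) / real (n k)" for k \<omega>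
  have [measurable]: "p j \<in> borel_measurable M" "q j \<in> borel_measurable M" for j
    unfolding p_def q_def pause_first_def pause_last_def by measurable
  have int: "integrable M (p j)" "integrable M (q j)" for j
    unfolding p_def q_def pause_first_def pause_last_def by (auto intro!: integrable_BF)
  have zero: "expectation (p j) = 0" "expectation (q j) = 0" for j
    unfolding p_def q_def pause_first_def pause_last_def
    using integrable_BF by (simp_all add: mean_BF del: sum.cl_ivl_Suc)
  have diff: "p j \<omega> - q j \<omega> = gain (int (Suc m * j) + 1) (int (m * j)) m \<omega>" for j \<omega>
    unfolding p_def q_def gain_def by (rule pause_first_diff_pause_last)
  have mean_min: "expectation (\<lambda>\<omega>. min (p j \<omega>) (q j \<omega>)) \<le> - (3 * c / 2)" for j
  proof -
    have "(\<lambda>\<omega>. min (p j \<omega>) (q j \<omega>)) = (\<lambda>\<omega>. (p j \<omega> + q j \<omega> - \<bar>p j \<omega> - q j \<omega>\<bar>) / 2)"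
      by (auto simp: min_def)
    then have "expectation (\<lambda>\<omega>. min (p j \<omega>) (q j \<omega>)) = - expectation (\<lambda>\<omega>. \<bar>p j \<omega> - q j \<omega>\<bar>) / 2"
      using int zero by simp
    then show ?thesis unfolding diff using gain[of "int (Suc m * j) + 1" "int (m * j)"] by simp
  qed
  have bound: "AE \<omega> in M. \<forall>j. \<bar>min (p j \<omega>) (q j \<omega>)\<bar> \<le> c * real (Suc m)"
    using AE_bounds
  proof eventually_elim
    case (elim \<omega>)
    have BF: "\<bar>B i \<omega> * F x \<omega>\<bar> \<le> c" for i x
    proof -
      have "\<bar>B i \<omega>\<bar> = 1" using elim by (metis abs_1 abs_minus_cancel)
      then show ?thesis using elim by (simp add: abs_mult less_imp_le)
    qed
    have "\<bar>\<Sum>i=1..Suc m. B (f i) \<omega> * F (g i) \<omega>\<bar> \<le> c * real (Suc m)" for f g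
      using order_trans[OF sum_abs sum_mono[OF BF], where K1="{1..Suc m}"] by (simp add: mult.commute)
    from this[of "\<lambda>i. int (Suc m * j + i)" "\<lambda>i. int (m * j + (i - 1))" for j]
      this[of "\<lambda>i. int (Suc m * j + i)" "\<lambda>i. int (m * j + min i m)" for j]
    have "\<bar>p j \<omega>\<bar> \<le> c * real (Suc m)" "\<bar>q j \<omega>\<bar> \<le> c * real (Suc m)" for j
      unfolding p_def q_def pause_first_def pause_last_def by simp_all
    then show ?case by (simp add: min_def)
  qed
  have "3 * c / 2 / real (Suc m) \<le> - (- \<Lambda> \<alpha>)"
  proof (rule expectation_le_AE_limit[where V=V and C=c])
    show "AE \<omega> in M. (\<lambda>k. - (min_action (\<lambda>i. B i \<omega>) (\<lambda>x. F x \<omega>) (n k) (round0 (\<alpha> * real (n k))) / real (n k)))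
        \<longlonglongrightarrow> - (- \<Lambda> \<alpha>)"
    proof (rule eventually_mono[OF shape_function_limit[OF assms, of \<alpha>]])
      have "strict_mono n" by (rule strict_monoI_Suc) (simp add: n_def)
      then show "(\<lambda>k. - (min_action (\<lambda>i. B i \<omega>) (\<lambda>x. F x \<omega>) (n k) (round0 (\<alpha> * real (n k))) / real (n k)))
        \<longlonglongrightarrow> - (- \<Lambda> \<alpha>)"
        if "(\<lambda>n. min_action (\<lambda>i. B i \<omega>) (\<lambda>x. F x \<omega>) n (round0 (\<alpha> * real n)) / real n) \<longlonglongrightarrow> - \<Lambda> \<alpha>" for \<omega>
        using LIMSEQ_subseq_LIMSEQ[OF that] by (intro tendsto_minus) (simp add: comp_def)
    qed (use \<alpha> in auto)
    show "V k \<in> borel_measurable M" for k unfolding V_def by measurable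
    show "AE \<omega> in M. \<bar>V k \<omega>\<bar> \<le> c" for k
      using bound
    proof eventually_elim
      case (elim \<omega>)
      have "\<bar>\<Sum>j<Suc k. min (p j \<omega>) (q j \<omega>)\<bar> \<le> (\<Sum>j<Suc k. c * real (Suc m))"
        using elim by (intro order_trans[OF sum_abs sum_mono]) blast
      also have "\<dots> = c * real (n k)" by (simp add: n_def algebra_simps)
      finally show ?case
        unfolding V_def using n_pos[of k] by (simp add: abs_divide divide_le_eq del: sum.lessThan_Suc)
    qed
    show "AE \<omega> in M. V k \<omega>
        \<le> - (min_action (\<lambda>i. B i \<omega>) (\<lambda>x. F x \<omega>) (n k) (round0 (\<alpha> * real (n k))) / real (n k))" for k
    proof (rule AE_I2)
      fix \<omega>
      have "\<alpha> * real (n k) = real (m * Suc k)" by (simp add: \<alpha>_def n_def field_simps)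
      then have "round0 (\<alpha> * real (n k)) = int (m * Suc k)" unfolding round0_def by (simp only: floor_of_nat of_nat_0_le_iff if_True)
      moreover have "min_action (\<lambda>i. B i \<omega>) (\<lambda>x. F x \<omega>) (n k) (int (m * Suc k))
          \<le> (\<Sum>j<Suc k. min (p j \<omega>) (q j \<omega>))"
        unfolding n_def p_def q_def by (rule min_action_blocks_le)
      ultimately show "V k \<omega>
          \<le> - (min_action (\<lambda>i. B i \<omega>) (\<lambda>x. F x \<omega>) (n k) (round0 (\<alpha> * real (n k))) / real (n k))"
        unfolding V_def minus_divide_left by (intro divide_right_mono) auto
    qed
    show "(\<lambda>_. 3 * c / 2 / real (Suc m)) \<longlonglongrightarrow> 3 * c / 2 / real (Suc m)" by simp
    show "3 * c / 2 / real (Suc m) \<le> expectation (V k)" for k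
    proof -
      have "expectation (V k) = - (\<Sum>j<Suc k. expectation (\<lambda>\<omega>. min (p j \<omega>) (q j \<omega>))) / real (n k)"
        unfolding V_def using int by (simp del: sum.lessThan_Suc)
      moreover have "(\<Sum>j<Suc k. expectation (\<lambda>\<omega>. min (p j \<omega>) (q j \<omega>))) \<le> (\<Sum>j<Suc k. - (3 * c / 2))"
        by (intro sum_mono mean_min)
      then have "real (Suc k) * (3 * c / 2) / real (n k)
          \<le> - (\<Sum>j<Suc k. expectation (\<lambda>\<omega>. min (p j \<omega>) (q j \<omega>))) / real (n k)"
        by (intro divide_right_mono) (simp_all del: sum.lessThan_Suc)
      moreover have "real (Suc k) * (3 * c / 2) / real (n k) = 3 * c / 2 / real (Suc m)"
        unfolding n_def of_nat_mult by (simp add: divide_simps del: of_nat_Suc)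
      ultimately show ?thesis by simp
    qed
  qed
  moreover have "c * (1 - \<alpha>) = c / real (Suc m)" by (simp add: \<alpha>_def field_simps)
  moreover have "c / real (Suc m) < 3 * c / 2 / real (Suc m)"
    using c_pos by (intro divide_strict_right_mono) auto
  ultimately show ?thesis using \<alpha> by (intro exI[of _ \<alpha>]) auto
qed

end

text \<open>Write \<open>\<alpha>\<close> as a convex combination of \<open>\<beta>\<close> and the
  endpoint on its other side. The chord is affine and meets \<open>f\<close> at both endpoints, so
  the excess at \<open>\<beta>\<close> survives, multiplied by a positive weight
  \<open>s\<close>.\<close>

lemma concave_on_above_chord:
  fixes f :: "real \<Rightarrow> real"
  assumes f: "concave_on {0..1} f" and "f 0 = c" "f 1 = 0"
    and \<beta>: "0 < \<beta>" "\<beta> < 1" "c * (1 - \<beta>) < f \<beta>" and \<alpha>: "0 < \<alpha>" "\<alpha> < 1"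
  shows "c * (1 - \<alpha>) < f \<alpha>"
proof (cases "\<alpha> \<le> \<beta>")
  case True
  define s where "s = \<alpha> / \<beta>"
  have s: "0 < s" "s \<le> 1" "s * \<beta> = \<alpha>" using True \<alpha> \<beta> by (auto simp: s_def)
  have "(1 - s) * f 0 + s * f \<beta> \<le> f \<alpha>"
    using concave_onD[OF f, of s 0 \<beta>] s \<beta> by simp
  moreover have "s * (c * (1 - \<beta>)) < s * f \<beta>" using \<beta> s by simp
  moreover have "s * (c * (1 - \<beta>)) = s * c - c * \<alpha>" using s(3) by (simp add: algebra_simps)
  moreover have "(1 - s) * f 0 = c - s * c" "c * (1 - \<alpha>) = c - c * \<alpha>"
    using assms(2) by (simp_all add: algebra_simps)
  ultimately show ?thesis by linarith
next
  case False
  define s where "s = (1 - \<alpha>) / (1 - \<beta>)"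
  have s: "0 < s" "s \<le> 1" "s * (1 - \<beta>) = 1 - \<alpha>" using False \<alpha> \<beta> by (auto simp: s_def)
  have "(1 - s) * f 1 + s * f \<beta> \<le> f ((1 - s) * 1 + s * \<beta>)"
    using concave_onD[OF f, of s 1 \<beta>] s \<beta> by simp
  moreover have "(1 - s) * 1 + s * \<beta> = \<alpha>" using s(3) by (simp add: algebra_simps)
  moreover have "s * (c * (1 - \<beta>)) < s * f \<beta>" using \<beta> s by simp
  moreover have "s * (c * (1 - \<beta>)) = c * (1 - \<alpha>)" using s(3) by (simp add: mult.left_commute)
  ultimately show ?thesis using assms(3) by simp
qed

theorem theorem2p2:
  fixes M :: "'a measure"
    and F B :: "int \<Rightarrow> 'a \<Rightarrow> real"
    and \<rho> :: "real \<Rightarrow> real"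
    and c q \<kappa> :: real
    and \<Lambda> :: "real \<Rightarrow> real"
  assumes "prob_space M"
    and c_pos: "c > 0" and q_pos: "q > 0" and kappa: "\<kappa> > -1"
    and indep: "prob_space.indep_vars M (\<lambda>_. borel)
                  (\<lambda>j. case j of Inl x \<Rightarrow> F x | Inr i \<Rightarrow> B i) (UNIV :: (int + int) set)"
    and B_meas: "\<And>i. B i \<in> borel_measurable M"
    and B_plus: "\<And>i. measure M {\<omega> \<in> space M. B i \<omega> = 1} = 1/2"
    and B_minus: "\<And>i. measure M {\<omega> \<in> space M. B i \<omega> = -1} = 1/2"
    and F_dens: "\<And>x. distributed M lborel (F x) (\<lambda>t. ennreal (\<rho> t))"
    and rho_even: "\<And>t. \<rho> (-t) = \<rho> t"
    and rho_cont: "continuous_on {-c<..<c} \<rho>"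
    and rho_pos: "\<And>t. -c < t \<Longrightarrow> t < c \<Longrightarrow> \<rho> t > 0"
    and rho_zero: "\<And>t. \<bar>t\<bar> \<ge> c \<Longrightarrow> \<rho> t = 0"
    and rho_edge: "((\<lambda>t. \<rho> t / (\<bar>c - t\<bar> powr \<kappa>)) \<longlongrightarrow> q) (at_left c)"
    and shape: "is_shape_function M B F \<Lambda>"
  shows "\<Lambda> 0 = c \<and> \<Lambda> 1 = 0 \<and> \<Lambda> (-1) = 0
         \<and> (\<forall>\<alpha>. 0 < \<bar>\<alpha>\<bar> \<and> \<bar>\<alpha>\<bar> < 1 \<longrightarrow> \<Lambda> \<alpha> > c * (1 - \<bar>\<alpha>\<bar>))
         \<and> (\<exists>K>0. \<forall>\<alpha>\<in>{-1..1}. \<Lambda> \<alpha> \<le> c - K * \<bar>\<alpha>\<bar>)"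
proof -
  interpret prob_space M by fact
  interpret random_environment M F B \<rho> c
    by unfold_locales (fact c_pos indep B_plus B_minus F_dens rho_even rho_pos rho_zero)+
  \<comment> \<open>Evenness carries the estimates for nonnegative speeds over to negative
    ones.\<close>
  have even: "\<Lambda> \<bar>\<alpha>\<bar> = \<Lambda> \<alpha>" if "\<alpha> \<in> {-1..1}" for \<alpha>
    using shape that unfolding is_shape_function_def by (auto simp: abs_if)
  have le: "\<Lambda> \<alpha> \<le> c - (c - expectation (\<lambda>\<omega>. \<bar>F 0 \<omega>\<bar>)) * \<bar>\<alpha>\<bar>" if "\<alpha> \<in> {-1..1}" for \<alpha>
    using shape_function_le[OF shape, of "\<bar>\<alpha>\<bar>"] even[OF that] that by auto
  \<comment> \<open>At speed 0 the linear upper bound reduces to \<open>c\<close>, which meets the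
    lower bound from traps.\<close>
  have zero: "\<Lambda> 0 = c" using shape_function_0_ge[OF shape] le[of 0] by simp
  note one = shape_function_1[OF shape]
  have "concave_on {-1..1} \<Lambda>" using shape unfolding is_shape_function_def by blast
  then have conc: "concave_on {0..1} \<Lambda>"
    unfolding concave_on_def by (rule convex_on_subset) auto
  obtain \<beta> where \<beta>: "0 < \<beta>" "\<beta> < 1" "c * (1 - \<beta>) < \<Lambda> \<beta>"
    using shape_function_exceeds_chord[OF shape] by blast
  have "c * (1 - \<bar>\<alpha>\<bar>) < \<Lambda> \<alpha>" if "0 < \<bar>\<alpha>\<bar>" "\<bar>\<alpha>\<bar> < 1" for \<alpha>
    using concave_on_above_chord[OF conc zero one \<beta> that] even[of \<alpha>] that by (simp add: abs_less_iff)
  moreover have "\<Lambda> (-1) = 0" using even[of "-1"] one by simp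
  moreover have "\<exists>K>0. \<forall>\<alpha>\<in>{-1..1}. \<Lambda> \<alpha> \<le> c - K * \<bar>\<alpha>\<bar>"
    using le mean_abs_F_less[of 0]
    by (intro exI[of _ "c - expectation (\<lambda>\<omega>. \<bar>F 0 \<omega>\<bar>)"]) auto
  ultimately show ?thesis using zero one by blast
qed

end
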